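(* Let $X$ be a real Banach space and $f:X\to\mathbb R$ a locally Lipschitz functional. Let $K$ be a compact metric space, $K^*$ a nonempty closed subset of $K$, and $p^*:K^*\to X$ a continuous map. Put $$\mathcal P=\{p\in C(K,X):\ p=p^*\text{ on }K^*\},\qquad c=\inf_{p\in\mathcal P}\max_{t\in K}f(p(t)).$$ Let $F$ be a closed subset of $X$ having no common point with $p^*(K^* )$. Assume that $$f(x)\ge c\quad\text{for every }x\in F,$$ and $$p(K)\cap F\ne\emptyset\quad\text{for all }p\in\mathcal P .$$ Then there exists a sequence $(x_n)$ in $X$ such that (i) $\lim_{n\to\infty}\mathrm{dist}(x_n,F)=0$; (ii) $\lim_{n\to\infty}f(x_n)=c$; (iii) $\lim_{n\to\infty}\lambda(x_n)=0$.
   Context: The generalized directional derivative is $f^0(x,v)=\limsup_{y\to x,\ \mu\searrow0}\frac{f(y+\mu v)-f(y)}{\mu}$. The Clarke generalized gradient is $\partial f(x)=\{x^*\in X^*:\ f^0(x,v)\ge\langle x^*,v\rangle\ \text{for all }v\in X\}$. Finally $\lambda(x)=\min_{x^*\in\partial f(x)}\|x^*\|$. *)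

theory Defs
  imports "HOL-Analysis.Analysis"
begin

definition locally_lipschitz :: "('a::metric_space \<Rightarrow> real) \<Rightarrow> bool" where
  "locally_lipschitz f \<longleftrightarrow> (\<forall>x. \<exists>U L. open U \<and> x \<in> U \<and> L-lipschitz_on U f)"

(* The limsup ranges over all y near x, with y = x allowed. *)
definition clarke_dd :: "('a::real_normed_vector \<Rightarrow> real) \<Rightarrow> 'a \<Rightarrow> 'a \<Rightarrow> ereal" where
  "clarke_dd f x v =
     Limsup (nhds x \<times>\<^sub>F at_right (0::real)) (\<lambda>(y, \<mu>). ereal ((f (y + \<mu> *\<^sub>R v) - f y) / \<mu>))"

definition clarke_gradient :: "('a::real_normed_vector \<Rightarrow> real) \<Rightarrow> 'a \<Rightarrow> ('a \<Rightarrow>\<^sub>L real) set" where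
  "clarke_gradient f x = {\<xi>. \<forall>v. clarke_dd f x v \<ge> ereal (blinfun_apply \<xi> v)}"

(* LEAST and GREATEST below are the literal minimum and maximum of a set of reals.
   They exist where they are used: for locally Lipschitz f the gradient is nonempty and
   weak-* compact, and a continuous function on a nonempty compact set attains its maximum. *)
definition clarke_lambda :: "('a::real_normed_vector \<Rightarrow> real) \<Rightarrow> 'a \<Rightarrow> real" where
  "clarke_lambda f x = (LEAST r. r \<in> norm ` clarke_gradient f x)"

definition admissible_maps ::
    "'k::metric_space set \<Rightarrow> 'k set \<Rightarrow> ('k \<Rightarrow> 'a::real_normed_vector) \<Rightarrow> ('k \<Rightarrow> 'a) set" where
  "admissible_maps K Kstar pstar = {p. continuous_on K p \<and> (\<forall>t\<in>Kstar. p t = pstar t)}"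

definition minimax_value ::
    "('a::real_normed_vector \<Rightarrow> real) \<Rightarrow> 'k::metric_space set \<Rightarrow> 'k set \<Rightarrow> ('k \<Rightarrow> 'a) \<Rightarrow> real" where
  "minimax_value f K Kstar pstar =
     (INF p\<in>admissible_maps K Kstar pstar. GREATEST r. r \<in> (\<lambda>t. f (p t)) ` K)"

end

(* Only maps in P that agree with a nearly optimal p0 at the times where p0 is far from F compete.
   Since f >= c on F, the maximum along such a map q of f plus a small Lipschitz penalty supported near F
   is bounded below, and Ekeland's principle yields a q that nearly minimizes it with small slope.
   At every time where the maximum is attained, q is near F and f is near c there.  If lambda were
   not small at all these points, a minimum-norm (Hahn-Banach) argument would give at each of them a
   direction of uniform descent; gluing the directions over the compact set of maximizing times moves
   q to a competitor that contradicts Ekeland's inequality. *)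

theory Submission
  imports Defs
begin

section \<open>Sublinear functionals and the Hahn-Banach theorem\<close>

text \<open>Without a penalty, the maximum of f along a map could sit at a time in
  \<open>Kstar\<close>, where no competitor may move. The penalty has height \<open>M * a\<close> on
  F and vanishes at distance \<open>a\<close> or more from F. Hence maximizing times are never
  frozen. Freezing \<open>Kstar\<close> alone would not do: a perturbed map could raise f at times
  when p0 is far from F, and the maximum could then escape to a place about which nothing is
  assumed. A second obstacle is that the maximizing times of a perturbed map need not maximize for
  the unperturbed one. The gluing therefore has to give an estimate at all times at once, with one
  bound on the step length, and the contradiction appears only for small steps.\<close>

definition sublinear :: "('a::real_vector \<Rightarrow> real) \<Rightarrow> bool" where
  "sublinear p \<longleftrightarrow> (\<forall>x y. p (x + y) \<le> p x + p y) \<and> (\<forall>c x. 0 < c \<longrightarrow> p (c *\<^sub>R x) = c * p x)"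

lemma sublinearI:
  assumes "\<And>x y. p (x + y) \<le> p x + p y" "\<And>c x. 0 < c \<Longrightarrow> p (c *\<^sub>R x) \<le> c * p x"
  shows "sublinear p"
proof -
  have "c * p x \<le> p (c *\<^sub>R x)" if "0 < c" for c x
    using assms(2)[of "1 / c" "c *\<^sub>R x"] that by (simp add: field_simps)
  then show ?thesis
    using assms by (auto simp: sublinear_def intro: antisym)
qed

lemma sublinear_add: "sublinear p \<Longrightarrow> p (x + y) \<le> p x + p y"
  and sublinear_scale: "sublinear p \<Longrightarrow> 0 < c \<Longrightarrow> p (c *\<^sub>R x) = c * p x"
  by (auto simp: sublinear_def)

lemma sublinear_zero: "sublinear p \<Longrightarrow> p 0 = 0"
  using sublinear_scale[of p 2 0] by simp

lemma sublinear_ge_minus: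
  assumes "sublinear p" shows "- p (- x) \<le> p x"
  using sublinear_add[OF assms, of x "- x"] sublinear_zero[OF assms] by simp

lemma sublinear_scale_nonneg: "sublinear p \<Longrightarrow> 0 \<le> c \<Longrightarrow> p (c *\<^sub>R x) = c * p x"
  using sublinear_scale[of p c x] sublinear_zero[of p] by (cases "c = 0") auto

text \<open>The infimum is finite because \<open>p x\<close> is at least \<open>- p (- x)\<close>,
  hence at least \<open>- q (- x)\<close>. Subadditivity uses the chain: values of two members at
  \<open>x\<close> and at \<open>y\<close> are both bounded below by those of the smaller
  member.\<close>

lemma sublinear_chain_INF:
  assumes "C \<noteq> {}" "\<And>p. p \<in> C \<Longrightarrow> sublinear p \<and> p \<le> q"
    and chain: "\<And>p r. p \<in> C \<Longrightarrow> r \<in> C \<Longrightarrow> p \<le> r \<or> r \<le> p"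
  shows "sublinear (\<lambda>x. INF p\<in>C. p x)" and "p \<in> C \<Longrightarrow> (INF p\<in>C. p x) \<le> p x"
proof -
  have bdd: "bdd_below ((\<lambda>p. p x) ` C)" for x
  proof (rule bdd_belowI2)
    fix p assume "p \<in> C"
    then show "- q (- x) \<le> p x"
      using assms(2)[of p] sublinear_ge_minus[of p x] by (force simp: le_fun_def dest: spec[of _ "- x"])
  qed
  show low: "p \<in> C \<Longrightarrow> (INF p\<in>C. p x) \<le> p x" for p x
    by (rule cINF_lower[OF bdd])
  show "sublinear (\<lambda>x. INF p\<in>C. p x)"
  proof (rule sublinearI)
    fix x y
    have "(INF p\<in>C. p (x + y)) \<le> p x + r y" if "p \<in> C" "r \<in> C" for p r
    proof -
      obtain s where "s \<in> C" "s x \<le> p x" "s y \<le> r y"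
        using chain[OF \<open>p \<in> C\<close> \<open>r \<in> C\<close>] \<open>p \<in> C\<close> \<open>r \<in> C\<close> by (auto simp: le_fun_def)
      then show ?thesis
        using low[of s "x + y"] assms(2)[of s] sublinear_add[of s x y] by linarith
    qed
    then have "(INF p\<in>C. p (x + y)) - r y \<le> (INF p\<in>C. p x)" if "r \<in> C" for r
      using that assms(1) by (intro cINF_greatest) (auto simp: algebra_simps)
    then have "(INF p\<in>C. p (x + y)) - (INF p\<in>C. p x) \<le> (INF p\<in>C. p y)"
      using assms(1) by (intro cINF_greatest) (auto simp: algebra_simps)
    then show "(INF p\<in>C. p (x + y)) \<le> (INF p\<in>C. p x) + (INF p\<in>C. p y)"
      by linarith
  next
    fix c :: real and x assume "0 < c"
    have "(INF p\<in>C. p (c *\<^sub>R x)) / c \<le> p x" if "p \<in> C" for p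
      using low[OF that, of "c *\<^sub>R x"] assms(2)[OF that] \<open>0 < c\<close> sublinear_scale[of p c x]
      by (simp add: divide_le_eq mult.commute)
    then have "(INF p\<in>C. p (c *\<^sub>R x)) / c \<le> (INF p\<in>C. p x)"
      using assms(1) by (intro cINF_greatest)
    then show "(INF p\<in>C. p (c *\<^sub>R x)) \<le> c * (INF p\<in>C. p x)"
      using \<open>0 < c\<close> by (simp add: divide_le_eq mult.commute)
  qed
qed

text \<open>For a direction \<open>a\<close>, the infimum over \<open>t\<close> >= 0 of
  \<open>p (x + t *\<^sub>R a) - t * p a\<close> is again sublinear and lies below \<open>p\<close>,
  so by minimality it is \<open>p\<close>. Taking \<open>t = 1\<close> yields
  \<open>p x + p a\<close> <= \<open>p (x + a)\<close>, the missing half of additivity.\<close>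

lemma sublinear_minimal_linear:
  assumes sub: "sublinear p" and min: "\<And>r. sublinear r \<Longrightarrow> r \<le> p \<Longrightarrow> r = p"
  shows "linear p"
proof -
  have add: "p (x + a) = p x + p a" for x a
  proof -
    define r where "r x = (INF t\<in>{0..}. p (x + t *\<^sub>R a) - t * p a)" for x
    have bdd: "bdd_below ((\<lambda>t. p (x + t *\<^sub>R a) - t * p a) ` {0..})" for x
    proof (rule bdd_belowI2)
      fix t :: real assume "t \<in> {0..}"
      then have "t * p a \<le> p (x + t *\<^sub>R a) + p (- x)"
        using sublinear_add[OF sub, of "x + t *\<^sub>R a" "- x"] sublinear_scale_nonneg[OF sub, of t a] by simp
      then show "- p (- x) \<le> p (x + t *\<^sub>R a) - t * p a" by simp
    qed
    have low: "r x \<le> p (x + t *\<^sub>R a) - t * p a" if "0 \<le> t" for x t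
      unfolding r_def using that by (intro cINF_lower[OF bdd]) simp
    have great: "u \<le> r x" if "\<And>t. 0 \<le> t \<Longrightarrow> u \<le> p (x + t *\<^sub>R a) - t * p a" for u x
      unfolding r_def using that by (intro cINF_greatest) auto
    have "sublinear r"
    proof (rule sublinearI)
      fix x y
      have *: "r (x + y) \<le> (p (x + s *\<^sub>R a) - s * p a) + (p (y + t *\<^sub>R a) - t * p a)"
        if "0 \<le> s" "0 \<le> t" for s t
        using low[of "s + t" "x + y"] sublinear_add[OF sub, of "x + s *\<^sub>R a" "y + t *\<^sub>R a"] that
        by (simp add: algebra_simps)
      have "r (x + y) - (p (y + t *\<^sub>R a) - t * p a) \<le> r x" if "0 \<le> t" for t
        using *[OF _ that] by (intro great) (simp add: algebra_simps)
      then have "r (x + y) - r x \<le> r y"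
        by (intro great) (simp add: algebra_simps)
      then show "r (x + y) \<le> r x + r y" by simp
    next
      fix c :: real and x assume c: "0 < c"
      have "r (c *\<^sub>R x) / c \<le> r x"
      proof (rule great)
        fix t :: real assume "0 \<le> t"
        then have "r (c *\<^sub>R x) \<le> p (c *\<^sub>R (x + t *\<^sub>R a)) - c * t * p a"
          using low[of "c * t" "c *\<^sub>R x"] c by (simp add: algebra_simps)
        also have "\<dots> = c * (p (x + t *\<^sub>R a) - t * p a)"
          unfolding sublinear_scale[OF sub c] by (simp add: algebra_simps)
        finally show "r (c *\<^sub>R x) / c \<le> p (x + t *\<^sub>R a) - t * p a"
          using c by (simp add: divide_le_eq mult.commute)
      qed
      then show "r (c *\<^sub>R x) \<le> c * r x"
        using c by (simp add: divide_le_eq mult.commute)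
    qed
    moreover have "r \<le> p"
      using low[of 0] by (auto simp: le_fun_def)
    ultimately have "r = p" by (rule min)
    then have "p x \<le> p (x + a) - p a"
      using low[of 1 x] by simp
    then show ?thesis
      using sublinear_add[OF sub, of x a] by simp
  qed
  have neg: "p (- x) = - p x" for x
    using add[of x "- x"] sublinear_zero[OF sub] by simp
  have "p (c *\<^sub>R x) = c * p x" for c x
  proof (cases "0 \<le> c")
    case False
    then show ?thesis
      using sublinear_scale_nonneg[OF sub, of "- c" x] neg[of "c *\<^sub>R x"] by simp
  qed (simp add: sublinear_scale_nonneg[OF sub])
  with add show ?thesis by (auto intro: linearI)
qed

text \<open>A pointwise minimal sublinear functional below \<open>q\<close> is linear. No functional
  on a subspace has to be extended: every constraint wanted later, including a norm bound, is put
  into \<open>q\<close>.\<close>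

lemma Hahn_Banach_sublinear:
  assumes "sublinear q"
  obtains g where "linear g" "\<And>x. g x \<le> q x"
proof -
  let ?A = "{p. sublinear p \<and> p \<le> q}"
  \<comment> \<open>The order is reversed, so that the maximal element from Zorn's lemma is a
    minimal functional.\<close>
  let ?R = "relation_of (\<lambda>p r. r \<le> p) ?A"
  have "\<exists>m\<in>?A. \<forall>p\<in>?A. p \<le> m \<longrightarrow> p = m"
  proof (rule predicate_Zorn)
    show "partial_order_on ?A ?R"
      by (rule partial_order_on_relation_ofI) auto
    fix C assume "C \<in> Chains ?R"
    then have C: "\<And>p. p \<in> C \<Longrightarrow> sublinear p \<and> p \<le> q" "\<And>p r. p \<in> C \<Longrightarrow> r \<in> C \<Longrightarrow> p \<le> r \<or> r \<le> p"
      by (auto simp: Chains_def relation_of_def)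
    show "\<exists>u\<in>?A. \<forall>p\<in>C. u \<le> p"
    proof (cases "C = {}")
      case True
      then show ?thesis using assms by auto
    next
      case False
      note inf = sublinear_chain_INF[OF False C, simplified]
      from False obtain p where "p \<in> C" by auto
      have "(\<lambda>x. INF p\<in>C. p x) \<le> p" if "p \<in> C" for p
        using inf(2) that by (auto simp: le_fun_def)
      then show ?thesis
        using inf(1) C(1) \<open>p \<in> C\<close> by (intro bexI[of _ "\<lambda>x. INF p\<in>C. p x"]) (auto intro: order_trans)
    qed
  qed
  then obtain m where "sublinear m" "m \<le> q" "\<And>p. sublinear p \<Longrightarrow> p \<le> m \<Longrightarrow> p = m"
    by (auto dest: order_trans)
  then show ?thesis
    using that[of m] sublinear_minimal_linear[of m] by (auto simp: le_fun_def)
qed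

section \<open>The Clarke derivative and the minimal norm of the gradient\<close>

lemma eventually_nhds_at_right_0:
  fixes x :: "'a::metric_space"
  shows "eventually P (nhds x \<times>\<^sub>F at_right (0::real)) \<longleftrightarrow>
    (\<exists>r>0. \<forall>y \<mu>. dist y x < r \<longrightarrow> 0 < \<mu> \<longrightarrow> \<mu> < r \<longrightarrow> P (y, \<mu>))" (is "?L \<longleftrightarrow> ?R")
proof
  assume ?L
  then obtain Pf Pg where P: "eventually Pf (nhds x)" "eventually Pg (at_right (0::real))"
    "\<And>y \<mu>. Pf y \<Longrightarrow> Pg \<mu> \<Longrightarrow> P (y, \<mu>)"
    unfolding eventually_prod_filter by auto
  from P(1) obtain r1 where "r1 > 0" "\<And>y. dist y x < r1 \<Longrightarrow> Pf y"
    unfolding eventually_nhds_metric by auto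
  moreover from P(2) obtain r2 where "r2 > 0" "\<And>\<mu>. 0 < \<mu> \<Longrightarrow> \<mu> < r2 \<Longrightarrow> Pg \<mu>"
    unfolding eventually_at_right_field by auto
  ultimately show ?R
    using P(3) by (intro exI[of _ "min r1 r2"]) auto
next
  assume ?R
  then obtain r where r: "r > 0" "\<And>y \<mu>. dist y x < r \<Longrightarrow> 0 < \<mu> \<Longrightarrow> \<mu> < r \<Longrightarrow> P (y, \<mu>)"
    by auto
  have "eventually (\<lambda>y. dist y x < r) (nhds x)"
    using r(1) by (auto simp: eventually_nhds_metric)
  moreover have "eventually (\<lambda>\<mu>. 0 < \<mu> \<and> \<mu> < r) (at_right (0::real))"
    using r(1) by (auto simp: eventually_at_right_field)
  ultimately show ?L
    unfolding eventually_prod_filter using r(2) by blast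
qed

text \<open>Since the limsup also runs over base points, the estimate holds at every
  \<open>y\<close> near \<open>x\<close> with one radius. This is what later allows several short
  moves in succession, each starting where the previous one ended.\<close>

lemma clarke_dd_less:
  assumes "clarke_dd f x v < ereal d"
  shows "\<exists>r>0. \<forall>y \<mu>. dist y x < r \<longrightarrow> 0 < \<mu> \<longrightarrow> \<mu> < r \<longrightarrow> f (y + \<mu> *\<^sub>R v) \<le> f y + d * \<mu>"
  using Limsup_lessD[OF assms[unfolded clarke_dd_def]]
  unfolding eventually_nhds_at_right_0
  by (force simp: divide_less_eq dest: less_imp_le)

lemma clarke_dd_leI:
  assumes "\<And>e. e > d \<Longrightarrow>
    \<exists>r>0. \<forall>y \<mu>. dist y x < r \<longrightarrow> 0 < \<mu> \<longrightarrow> \<mu> < r \<longrightarrow> f (y + \<mu> *\<^sub>R v) \<le> f y + e * \<mu>"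
  shows "clarke_dd f x v \<le> ereal d"
proof -
  have "clarke_dd f x v \<le> ereal e" if "e > d" for e
    unfolding clarke_dd_def
  proof (rule Limsup_bounded)
    from assms[OF that] obtain r where "r > 0"
      "\<And>y \<mu>. dist y x < r \<Longrightarrow> 0 < \<mu> \<Longrightarrow> \<mu> < r \<Longrightarrow> f (y + \<mu> *\<^sub>R v) \<le> f y + e * \<mu>" by auto
    then show "\<forall>\<^sub>F z in nhds x \<times>\<^sub>F at_right 0. (case z of (y, \<mu>) \<Rightarrow> ereal ((f (y + \<mu> *\<^sub>R v) - f y) / \<mu>)) \<le> ereal e"
      unfolding eventually_nhds_at_right_0 by (intro exI[of _ r]) (auto simp: divide_le_eq algebra_simps)
  qed
  then show ?thesis
    by (metis dense_ge ereal_dense2 ereal_less_eq(3) less_ereal.simps(1) linorder_not_le order_less_imp_le order.trans)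
qed

lemma locally_lipschitzE:
  assumes "locally_lipschitz f"
  obtains L r where "L \<ge> 0" "r > 0"
    "\<And>y z. dist y x < r \<Longrightarrow> dist z x < r \<Longrightarrow> \<bar>f y - f z\<bar> \<le> L * dist y z"
proof -
  obtain U L where "open U" "x \<in> U" "L-lipschitz_on U f"
    using assms unfolding locally_lipschitz_def by blast
  moreover then obtain r where "r > 0" "ball x r \<subseteq> U"
    by (meson openE)
  ultimately show ?thesis
    using that[of L r] by (auto simp: lipschitz_on_def dist_real_def dist_commute subset_eq)
qed

lemma locally_lipschitz_continuous:
  assumes "locally_lipschitz f"
  shows "continuous_on S f"
proof -
  have "isCont f x" for x
  proof -
    obtain U L where "open U" "x \<in> U" "L-lipschitz_on U f"
      using assms unfolding locally_lipschitz_def by blast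
    then show ?thesis
      using lipschitz_on_continuous_on continuous_on_eq_continuous_at by blast
  qed
  then show ?thesis
    by (simp add: continuous_at_imp_continuous_on)
qed

lemma small_step:
  fixes v :: "'a::real_normed_vector"
  assumes "r > 0"
  obtains s where "s > 0" "s \<le> r" "\<And>y \<mu> x. dist y x < s \<Longrightarrow> 0 < \<mu> \<Longrightarrow> \<mu> < s \<Longrightarrow> dist (y + \<mu> *\<^sub>R v) x < r"
proof
  define s where "s = r / (2 + norm v)"
  have pos: "2 + norm v > 0" by (smt (verit) norm_ge_zero)
  show "s > 0" using assms pos by (simp add: s_def)
  show "s \<le> r" using assms pos by (simp add: s_def divide_le_eq)
  fix y x :: 'a and \<mu> :: real assume *: "dist y x < s" "0 < \<mu>" "\<mu> < s"
  have "dist (y + \<mu> *\<^sub>R v) x \<le> dist y x + \<mu> * norm v"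
    using *(2) norm_triangle_ineq[of "y - x" "\<mu> *\<^sub>R v"] by (simp add: dist_norm algebra_simps)
  also have "\<dots> \<le> dist y x + s * norm v"
    using *(3) by (simp add: mult_right_mono)
  also have "\<dots> < s * (1 + norm v)"
    using *(1) by (simp add: algebra_simps)
  also have "\<dots> \<le> s * (2 + norm v)"
    using \<open>s > 0\<close> by simp
  also have "\<dots> = r" using pos by (simp add: s_def)
  finally show "dist (y + \<mu> *\<^sub>R v) x < r" .
qed

definition clarke_real :: "('a::real_normed_vector \<Rightarrow> real) \<Rightarrow> 'a \<Rightarrow> 'a \<Rightarrow> real" where
  "clarke_real f x v = real_of_ereal (clarke_dd f x v)"

lemma clarke_dd_bounds:
  assumes "locally_lipschitz f"
  obtains L where "L \<ge> 0" "\<And>v. ereal (- L * norm v) \<le> clarke_dd f x v" "\<And>v. clarke_dd f x v \<le> ereal (L * norm v)"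
proof -
  obtain L r where L: "L \<ge> 0" "r > 0"
    "\<And>y z. dist y x < r \<Longrightarrow> dist z x < r \<Longrightarrow> \<bar>f y - f z\<bar> \<le> L * dist y z"
    using locally_lipschitzE[OF assms, of x] by blast
  have "\<exists>s>0. \<forall>y \<mu>. dist y x < s \<longrightarrow> 0 < \<mu> \<longrightarrow> \<mu> < s \<longrightarrow> \<bar>f (y + \<mu> *\<^sub>R v) - f y\<bar> \<le> L * norm v * \<mu>" for v
  proof -
    obtain s where s: "s > 0" "s \<le> r"
      "\<And>y \<mu> x. dist y x < s \<Longrightarrow> 0 < \<mu> \<Longrightarrow> \<mu> < s \<Longrightarrow> dist (y + \<mu> *\<^sub>R v) x < r"
      using small_step[OF L(2)] by blast
    have "\<bar>f (y + \<mu> *\<^sub>R v) - f y\<bar> \<le> L * norm v * \<mu>" if "dist y x < s" "0 < \<mu>" "\<mu> < s" for y \<mu>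
      using L(3)[of "y + \<mu> *\<^sub>R v" y] s that by (simp add: dist_norm mult_ac)
    with s(1) show ?thesis by blast
  qed
  then obtain s where s: "\<And>v. s v > 0"
    "\<And>v y \<mu>. dist y x < s v \<Longrightarrow> 0 < \<mu> \<Longrightarrow> \<mu> < s v \<Longrightarrow> \<bar>f (y + \<mu> *\<^sub>R v) - f y\<bar> \<le> L * norm v * \<mu>"
    by metis
  have "clarke_dd f x v \<le> ereal (L * norm v)" for v
  proof (rule clarke_dd_leI)
    fix e assume e: "L * norm v < e"
    have "f (y + \<mu> *\<^sub>R v) \<le> f y + e * \<mu>" if "dist y x < s v" "0 < \<mu>" "\<mu> < s v" for y \<mu>
      using s(2)[OF that] mult_right_mono[of "L * norm v" e \<mu>] e that(2) by linarith
    with s(1) show "\<exists>r>0. \<forall>y \<mu>. dist y x < r \<longrightarrow> 0 < \<mu> \<longrightarrow> \<mu> < r \<longrightarrow> f (y + \<mu> *\<^sub>R v) \<le> f y + e * \<mu>"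
      by blast
  qed
  moreover have "ereal (- L * norm v) \<le> clarke_dd f x v" for v
  \<comment> \<open>A smaller limsup would force too fast a descent; a single short step
    \<open>m\<close> from \<open>y = x\<close> already violates the Lipschitz bound.\<close>
  proof (rule ccontr)
    assume "\<not> ?thesis"
    then obtain d where d: "clarke_dd f x v < ereal d" "d < - L * norm v"
      using ereal_dense2[of "clarke_dd f x v" "ereal (- L * norm v)"] by (auto simp: not_le)
    from clarke_dd_less[OF d(1)] obtain t where t: "t > 0"
      "\<And>y \<mu>. dist y x < t \<Longrightarrow> 0 < \<mu> \<Longrightarrow> \<mu> < t \<Longrightarrow> f (y + \<mu> *\<^sub>R v) \<le> f y + d * \<mu>"
      by auto
    define m where "m = min (s v) t / 2"
    have m: "0 < m" "m < s v" "m < t" using s(1)[of v] t(1) by (auto simp: m_def min_def)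
    have "d * m < - L * norm v * m" using d(2) m(1) by (rule mult_strict_right_mono)
    then show False
      using s(2)[of x v m] s(1)[of v] t(2)[of x m] t(1) m by simp
  qed
  ultimately show ?thesis
    using that[of L] L(1) by blast
qed

lemma ereal_clarke_real:
  assumes "locally_lipschitz f"
  shows "clarke_dd f x v = ereal (clarke_real f x v)"
proof -
  obtain L where "ereal (- L * norm v) \<le> clarke_dd f x v" "clarke_dd f x v \<le> ereal (L * norm v)"
    using clarke_dd_bounds[OF assms] by metis
  then show ?thesis
    unfolding clarke_real_def by (cases "clarke_dd f x v") auto
qed

lemma clarke_real_less:
  assumes "locally_lipschitz f" "clarke_real f x v < d"
  obtains r where "r > 0" "\<And>y \<mu>. dist y x < r \<Longrightarrow> 0 < \<mu> \<Longrightarrow> \<mu> < r \<Longrightarrow> f (y + \<mu> *\<^sub>R v) \<le> f y + d * \<mu>"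
  using clarke_dd_less[of f x v d] assms by (auto simp: ereal_clarke_real)

text \<open>Subadditivity comes from going from \<open>y\<close> to
  \<open>y + \<mu> *\<^sub>R w\<close> and on in direction \<open>v\<close>: the intermediate point
  is an admissible base point, being near \<open>x\<close>. Homogeneity is a rescaling of the
  step.\<close>

lemma sublinear_clarke_real:
  assumes f: "locally_lipschitz f"
  shows "sublinear (clarke_real f x)"
proof (rule sublinearI)
  fix v w
  have "clarke_dd f x (v + w) \<le> ereal (clarke_real f x v + clarke_real f x w)"
  proof (rule clarke_dd_leI)
    fix e assume "clarke_real f x v + clarke_real f x w < e"
    then obtain a b where ab: "clarke_real f x v < a" "clarke_real f x w < b" "a + b = e"
      using that[of "clarke_real f x v + (e - (clarke_real f x v + clarke_real f x w)) / 2"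
                    "clarke_real f x w + (e - (clarke_real f x v + clarke_real f x w)) / 2"]
      by (simp add: field_simps)
    obtain r where r: "r > 0"
      "\<And>y \<mu>. dist y x < r \<Longrightarrow> 0 < \<mu> \<Longrightarrow> \<mu> < r \<Longrightarrow> f (y + \<mu> *\<^sub>R v) \<le> f y + a * \<mu>"
      using clarke_real_less[OF f ab(1)] by blast
    obtain t where t: "t > 0"
      "\<And>y \<mu>. dist y x < t \<Longrightarrow> 0 < \<mu> \<Longrightarrow> \<mu> < t \<Longrightarrow> f (y + \<mu> *\<^sub>R w) \<le> f y + b * \<mu>"
      using clarke_real_less[OF f ab(2)] by blast
    obtain s where s: "s > 0" "s \<le> r"
      "\<And>y \<mu> x. dist y x < s \<Longrightarrow> 0 < \<mu> \<Longrightarrow> \<mu> < s \<Longrightarrow> dist (y + \<mu> *\<^sub>R w) x < r"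
      using small_step[OF r(1)] by blast
    have "f (y + \<mu> *\<^sub>R (v + w)) \<le> f y + e * \<mu>" if "dist y x < min s t" "0 < \<mu>" "\<mu> < min s t" for y \<mu>
      using r(2)[of "y + \<mu> *\<^sub>R w" \<mu>] t(2)[of y \<mu>] s that ab(3) by (auto simp: algebra_simps)
    then show "\<exists>r>0. \<forall>y \<mu>. dist y x < r \<longrightarrow> 0 < \<mu> \<longrightarrow> \<mu> < r \<longrightarrow> f (y + \<mu> *\<^sub>R (v + w)) \<le> f y + e * \<mu>"
      using s(1) t(1) by (intro exI[of _ "min s t"]) auto
  qed
  then show "clarke_real f x (v + w) \<le> clarke_real f x v + clarke_real f x w"
    by (simp add: ereal_clarke_real[OF f])
next
  fix c :: real and v assume c: "0 < c"
  have "clarke_dd f x (c *\<^sub>R v) \<le> ereal (c * clarke_real f x v)"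
  proof (rule clarke_dd_leI)
    fix e assume "c * clarke_real f x v < e"
    then have "clarke_real f x v < e / c" using c by (simp add: less_divide_eq mult.commute)
    then obtain r where r: "r > 0"
      "\<And>y \<mu>. dist y x < r \<Longrightarrow> 0 < \<mu> \<Longrightarrow> \<mu> < r \<Longrightarrow> f (y + \<mu> *\<^sub>R v) \<le> f y + e / c * \<mu>"
      using clarke_real_less[OF f] by blast
    have "f (y + \<mu> *\<^sub>R c *\<^sub>R v) \<le> f y + e * \<mu>" if "dist y x < r" "0 < \<mu>" "\<mu> < r / c" for y \<mu>
      using r(2)[of y "\<mu> * c"] that c by (simp add: less_divide_eq)
    then show "\<exists>r>0. \<forall>y \<mu>. dist y x < r \<longrightarrow> 0 < \<mu> \<longrightarrow> \<mu> < r \<longrightarrow> f (y + \<mu> *\<^sub>R c *\<^sub>R v) \<le> f y + e * \<mu>"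
      using r(1) c by (intro exI[of _ "min r (r / c)"]) auto
  qed
  then show "clarke_real f x (c *\<^sub>R v) \<le> c * clarke_real f x v"
    by (simp add: ereal_clarke_real[OF f])
qed

text \<open>\<open>q\<close> is the infimal convolution of \<open>s\<close> and
  \<open>d * norm\<close>, the largest sublinear functional below both; the lower bound on
  \<open>s\<close> keeps it finite. A linear functional below \<open>q\<close> is then dominated by
  \<open>s\<close> and has norm at most \<open>d\<close> at the same time.\<close>

lemma sublinear_infconv_norm:
  fixes s :: "'a::real_normed_vector \<Rightarrow> real"
  assumes s: "sublinear s" and lower: "\<And>v. s v \<ge> - d * norm v" and d: "d \<ge> 0"
  obtains q where "sublinear q" "\<And>v. q v \<le> s v" "\<And>v. q v \<le> d * norm v"
proof -
  define q where "q v = (INF w. s w + d * norm (v - w))" for v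
  have bdd: "bdd_below (range (\<lambda>w. s w + d * norm (v - w)))" for v
  proof (rule bdd_belowI2)
    fix w
    have "d * norm w \<le> d * (norm v + norm (v - w))"
      using norm_triangle_ineq4[of v "v - w"] d by (intro mult_left_mono) auto
    then show "- d * norm v \<le> s w + d * norm (v - w)"
      using lower[of w] by (simp add: algebra_simps)
  qed
  have low: "q v \<le> s w + d * norm (v - w)" for v w
    unfolding q_def by (rule cINF_lower[OF bdd]) simp
  have great: "u \<le> q v" if "\<And>w. u \<le> s w + d * norm (v - w)" for u v
    unfolding q_def using that by (intro cINF_greatest) auto
  have "sublinear q"
  proof (rule sublinearI)
    fix v v'
    have *: "q (v + v') \<le> (s w + d * norm (v - w)) + (s w' + d * norm (v' - w'))" for w w'
    proof -
      have "d * norm (v + v' - (w + w')) \<le> d * (norm (v - w) + norm (v' - w'))"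
        using norm_triangle_ineq[of "v - w" "v' - w'"] d by (intro mult_left_mono) (auto simp: algebra_simps)
      then show ?thesis
        using low[of "v + v'" "w + w'"] sublinear_add[OF s, of w w'] by (simp add: algebra_simps)
    qed
    have "q (v + v') - (s w' + d * norm (v' - w')) \<le> q v" for w'
      using * by (intro great) (simp add: algebra_simps)
    then have "q (v + v') - q v \<le> q v'"
      by (intro great) (simp add: algebra_simps)
    then show "q (v + v') \<le> q v + q v'" by simp
  next
    fix c :: real and v assume c: "0 < c"
    have "q (c *\<^sub>R v) / c \<le> q v"
    proof (rule great)
      fix w
      have "q (c *\<^sub>R v) \<le> s (c *\<^sub>R w) + d * norm (c *\<^sub>R (v - w))"
        using low[of "c *\<^sub>R v" "c *\<^sub>R w"] by (simp only: scaleR_right_diff_distrib)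
      also have "\<dots> = c * (s w + d * norm (v - w))"
        unfolding sublinear_scale[OF s c] norm_scaleR using c by (simp add: distrib_left)
      finally show "q (c *\<^sub>R v) / c \<le> s w + d * norm (v - w)"
        using c by (simp add: divide_le_eq mult.commute)
    qed
    then show "q (c *\<^sub>R v) \<le> c * q v"
      using c by (simp add: divide_le_eq mult.commute)
  qed
  moreover have "q v \<le> s v" for v using low[of v v] by simp
  moreover have "q v \<le> d * norm v" for v using low[of v 0] sublinear_zero[OF s] by simp
  ultimately show ?thesis by (rule that)
qed

text \<open>From right to left, Hahn-Banach is applied to the infimal convolution of the Clarke
  derivative with \<open>d * norm\<close>. Read contrapositively, the equivalence turns a lower
  bound on the norms in the gradient into a direction of descent at rate greater than
  \<open>d\<close>.\<close>

lemma clarke_gradient_norm_le_iff: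
  assumes f: "locally_lipschitz f" and d: "d \<ge> 0"
  shows "(\<exists>\<xi>\<in>clarke_gradient f x. norm \<xi> \<le> d) \<longleftrightarrow> (\<forall>v. clarke_real f x v \<ge> - d * norm v)"
    (is "?L \<longleftrightarrow> ?R")
proof
  assume ?L
  then obtain \<xi> where xi: "\<xi> \<in> clarke_gradient f x" "norm \<xi> \<le> d" by auto
  show ?R
  proof
    fix v
    have "\<bar>blinfun_apply \<xi> v\<bar> \<le> d * norm v"
      using norm_blinfun[of \<xi> v] xi(2) mult_right_mono[of "norm \<xi>" d "norm v"] by auto
    moreover have "blinfun_apply \<xi> v \<le> clarke_real f x v"
      using xi(1) by (auto simp: clarke_gradient_def ereal_clarke_real[OF f])
    ultimately show "- d * norm v \<le> clarke_real f x v" by auto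
  qed
next
  assume ?R
  then obtain q where q: "sublinear q" "\<And>v. q v \<le> clarke_real f x v" "\<And>v. q v \<le> d * norm v"
    using sublinear_infconv_norm[OF sublinear_clarke_real[OF f] _ d] by blast
  obtain g where g: "linear g" "\<And>v. g v \<le> q v"
    using Hahn_Banach_sublinear[OF q(1)] by blast
  have ab: "norm (g v) \<le> norm v * d" for v
    using g(2)[of v] g(2)[of "- v"] q(3)[of v] q(3)[of "- v"] linear_neg[OF g(1), of v]
    by (auto simp: mult.commute)
  then have bl: "bounded_linear g"
    using g(1) by (auto intro!: bounded_linear_intro[of _ d] simp: linear_add linear_scale)
  have "norm (Blinfun g) \<le> d"
    using ab d bounded_linear_Blinfun_apply[OF bl]
    by (intro norm_blinfun_bound) (auto simp: mult.commute)
  moreover have "Blinfun g \<in> clarke_gradient f x"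
    using g(2) q(2) bounded_linear_Blinfun_apply[OF bl]
    by (auto simp: clarke_gradient_def ereal_clarke_real[OF f] intro: order_trans)
  ultimately show ?L by blast
qed

text \<open>The minimum is attained without an appeal to weak-star compactness. With
  \<open>m\<close> the infimum of the norms, the inequality \<open>- d * norm v\<close> <=
  \<open>clarke_real f x v\<close> holds for all \<open>d > m\<close>, hence for
  \<open>d = m\<close>, and the preceding equivalence returns an element of norm at most
  \<open>m\<close>. This justifies the \<open>LEAST\<close> in \<open>clarke_lambda\<close>.\<close>

lemma clarke_lambda_eq_norm:
  assumes f: "locally_lipschitz f"
  obtains \<xi> where "\<xi> \<in> clarke_gradient f x" "clarke_lambda f x = norm \<xi>"
    "\<And>\<zeta>. \<zeta> \<in> clarke_gradient f x \<Longrightarrow> norm \<xi> \<le> norm \<zeta>"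
proof -
  let ?N = "norm ` clarke_gradient f x"
  obtain L where "L \<ge> 0" "\<And>v. ereal (- L * norm v) \<le> clarke_dd f x v"
    using clarke_dd_bounds[OF f] by metis
  then have "clarke_gradient f x \<noteq> {}"
    using clarke_gradient_norm_le_iff[OF f, of L x] by (auto simp: ereal_clarke_real[OF f])
  have bdd: "bdd_below ?N" by (auto intro: bdd_belowI[of _ 0])
  define m where "m = Inf ?N"
  have m0: "m \<ge> 0"
    unfolding m_def using \<open>clarke_gradient f x \<noteq> {}\<close> by (intro cInf_greatest) auto
  have "- m * norm v \<le> clarke_real f x v" for v
  proof (cases "v = 0")
    case True
    then show ?thesis by (simp add: sublinear_zero[OF sublinear_clarke_real[OF f]])
  next
    case False
    have "- clarke_real f x v / norm v \<le> d" if md: "m < d" for d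
    proof -
      obtain \<zeta> where "\<zeta> \<in> clarke_gradient f x" "norm \<zeta> < d"
        using md \<open>clarke_gradient f x \<noteq> {}\<close> cInf_lessD[of ?N d] by (auto simp: m_def)
      then have "- d * norm v \<le> clarke_real f x v"
        using clarke_gradient_norm_le_iff[OF f, of d x] m0 md by force
      then have "- clarke_real f x v \<le> d * norm v" by simp
      then show ?thesis using False by (subst pos_divide_le_eq) auto
    qed
    then have "- clarke_real f x v / norm v \<le> m" by (rule dense_ge)
    then have "- clarke_real f x v \<le> m * norm v"
      using False by (subst (asm) pos_divide_le_eq) auto
    then show ?thesis by simp
  qed
  then obtain \<xi> where xi: "\<xi> \<in> clarke_gradient f x" "norm \<xi> \<le> m"
    using clarke_gradient_norm_le_iff[OF f m0, of x] by auto
  have min: "norm \<xi> \<le> norm \<zeta>" if "\<zeta> \<in> clarke_gradient f x" for \<zeta>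
    using xi(2) cInf_lower[of "norm \<zeta>" ?N] bdd that by (auto simp: m_def)
  have "clarke_lambda f x = norm \<xi>"
    unfolding clarke_lambda_def using xi(1) min by (intro Least_equality) auto
  with xi(1) show ?thesis using min by (rule that)
qed

lemma clarke_lambda_nonneg: "locally_lipschitz f \<Longrightarrow> 0 \<le> clarke_lambda f x"
  by (metis clarke_lambda_eq_norm norm_ge_zero)

text \<open>No gradient element has norm at most \<open>d\<close>, so some direction has Clarke
  derivative below \<open>- d * norm v\<close>. Normalizing it makes \<open>\<mu>\<close> the length
  of the step, and strictness of the inequality leaves room to reach the rate \<open>d\<close>
  itself at all nearby base points.\<close>

lemma clarke_lambda_greater_descent:
  assumes f: "locally_lipschitz f" and d: "0 \<le> d" and greater: "d < clarke_lambda f x"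
  obtains v r where "norm v = 1" "r > 0"
    "\<And>y \<mu>. dist y x < r \<Longrightarrow> 0 < \<mu> \<Longrightarrow> \<mu> < r \<Longrightarrow> f (y + \<mu> *\<^sub>R v) \<le> f y - d * \<mu>"
proof -
  note s = sublinear_clarke_real[OF f, of x]
  have "\<not> (\<exists>\<xi>\<in>clarke_gradient f x. norm \<xi> \<le> d)"
    using greater by (metis clarke_lambda_eq_norm[OF f] linorder_not_le order_trans)
  then obtain v where v: "clarke_real f x v < - d * norm v"
    using clarke_gradient_norm_le_iff[OF f d] by (auto simp: not_le)
  then have "v \<noteq> 0" using sublinear_zero[OF s] by auto
  define u where "u = (1 / norm v) *\<^sub>R v"
  have "clarke_real f x u < - d"
    using v \<open>v \<noteq> 0\<close> by (simp add: u_def sublinear_scale[OF s] divide_less_eq)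
  then obtain r where "r > 0" "\<And>y \<mu>. dist y x < r \<Longrightarrow> 0 < \<mu> \<Longrightarrow> \<mu> < r \<Longrightarrow> f (y + \<mu> *\<^sub>R u) \<le> f y + - d * \<mu>"
    using clarke_real_less[OF f] by blast
  moreover have "norm u = 1" using \<open>v \<noteq> 0\<close> by (simp add: u_def)
  ultimately show ?thesis using that by auto
qed

section \<open>Ekeland's principle and extension of continuous maps\<close>

text \<open>\<open>T x\<close> collects the points whose descent from \<open>x\<close> pays for the
  distance at rate \<open>\<kappa>\<close>; the triangle inequality makes this relation transitive.
  Moving repeatedly to a point almost lowest in the current set gives nested closed sets of diameter
  tending to 0. Their common point \<open>a\<close> satisfies \<open>T a = {a}\<close>, which is the
  last conclusion.\<close>

theorem Ekeland_variational_principle: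
  fixes \<psi> :: "'b::complete_space \<Rightarrow> real"
  assumes lsc: "\<And>\<alpha>. closed {x \<in> S. \<psi> x \<le> \<alpha>}"
    and lower: "\<And>x. x \<in> S \<Longrightarrow> b \<le> \<psi> x"
    and "x0 \<in> S" and k: "\<kappa> > 0"
  obtains x where "x \<in> S" "\<psi> x + \<kappa> * dist x0 x \<le> \<psi> x0"
    "\<And>y. y \<in> S \<Longrightarrow> \<psi> x - \<kappa> * dist x y \<le> \<psi> y"
proof -
  define T where "T x = {y \<in> S. \<psi> y + \<kappa> * dist x y \<le> \<psi> x}" for x
  have T_trans: "T y \<subseteq> T x" if "y \<in> T x" for x y
  proof
    fix z assume "z \<in> T y"
    moreover have "\<kappa> * dist x z \<le> \<kappa> * (dist x y + dist y z)"
      using k by (intro mult_left_mono dist_triangle) auto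
    ultimately show "z \<in> T x" using that by (auto simp: T_def algebra_simps)
  qed
  have T_self: "x \<in> T x" if "x \<in> S" for x using that by (simp add: T_def)
  have T_sub: "T x \<subseteq> S" for x by (auto simp: T_def)
  have T_closed: "closed (T x)" for x
  proof (unfold closed_sequential_limits, intro allI impI, elim conjE)
    fix u l assume u: "\<forall>n. u n \<in> T x" "u \<longlonglongrightarrow> l"
    have lim: "(\<lambda>n. \<psi> x - \<kappa> * dist x (u n)) \<longlonglongrightarrow> \<psi> x - \<kappa> * dist x l"
      using u(2) by (intro tendsto_intros)
    \<comment> \<open>The bound on \<open>\<psi> (u n)\<close> varies with \<open>n\<close>; the
      slack \<open>e\<close> places almost all \<open>u n\<close> in one sublevel set, to which
      \<open>lsc\<close> applies.\<close>
    have "l \<in> S \<and> \<psi> l \<le> \<psi> x - \<kappa> * dist x l + e" if "e > 0" for e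
    proof -
      have "\<forall>\<^sub>F n in sequentially. \<psi> x - \<kappa> * dist x (u n) < \<psi> x - \<kappa> * dist x l + e"
        using that by (intro order_tendstoD(2)[OF lim]) simp
      then have "\<forall>\<^sub>F n in sequentially. u n \<in> {y \<in> S. \<psi> y \<le> \<psi> x - \<kappa> * dist x l + e}"
      proof eventually_elim
        case (elim n)
        with u(1) show ?case by (auto simp: T_def dest!: spec[of _ n])
      qed
      from Lim_in_closed_set[OF lsc this _ u(2)] show ?thesis by simp
    qed
    then have "l \<in> S" "\<psi> l \<le> \<psi> x - \<kappa> * dist x l"
      by (auto intro: field_le_epsilon zero_less_one)
    then show "l \<in> T x" by (simp add: T_def)
  qed
  have bdd: "bdd_below (\<psi> ` T x)" for x
    using lower T_sub by (intro bdd_belowI2[of _ b]) auto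
  have step: "\<exists>y \<in> T x. \<forall>z \<in> T y. \<psi> y - \<psi> z < e" if xe: "x \<in> S" "e > 0" for x e
  proof -
    obtain y where y: "y \<in> T x" "\<psi> y < (INF z\<in>T x. \<psi> z) + e"
      using cInf_lessD[of "\<psi> ` T x" "(INF z\<in>T x. \<psi> z) + e"] T_self[OF xe(1)] xe(2) by auto
    have "\<psi> y - \<psi> z < e" if "z \<in> T y" for z
      using cINF_lower[OF bdd, of z x] T_trans[OF y(1)] that y(2) by auto
    with y(1) show ?thesis by blast
  qed
  \<comment> \<open>Points of \<open>T (u n)\<close> pay \<open>\<kappa>\<close> times their
    distance from \<open>u n\<close> by descent, so a possible descent below
    \<open>\<kappa> / Suc n\<close> confines them to distance \<open>1 / Suc n\<close>.\<close>
  have "\<exists>u. \<forall>n. (u n \<in> T x0 \<and> (\<forall>z\<in>T (u n). \<psi> (u n) - \<psi> z < \<kappa> / Suc n)) \<and> u (Suc n) \<in> T (u n)"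
  proof (rule dependent_nat_choice)
    show "\<exists>x. x \<in> T x0 \<and> (\<forall>z\<in>T x. \<psi> x - \<psi> z < \<kappa> / Suc 0)"
      using step[OF \<open>x0 \<in> S\<close>, of \<kappa>] k by auto
    fix x n assume x: "x \<in> T x0 \<and> (\<forall>z\<in>T x. \<psi> x - \<psi> z < \<kappa> / Suc n)"
    obtain y where "y \<in> T x" "\<forall>z\<in>T y. \<psi> y - \<psi> z < \<kappa> / Suc (Suc n)"
      using step[of x "\<kappa> / Suc (Suc n)"] x T_sub k by auto
    then show "\<exists>y. (y \<in> T x0 \<and> (\<forall>z\<in>T y. \<psi> y - \<psi> z < \<kappa> / Suc (Suc n))) \<and> y \<in> T x"
      using x T_trans by blast
  qed
  then obtain u where u: "\<And>n. u n \<in> T x0" "\<And>n z. z \<in> T (u n) \<Longrightarrow> \<psi> (u n) - \<psi> z < \<kappa> / Suc n"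
    "\<And>n. u (Suc n) \<in> T (u n)" by auto
  have small: "dist (u n) z < 1 / Suc n" if "z \<in> T (u n)" for n z
  proof -
    have "\<kappa> * dist (u n) z < \<kappa> * (1 / Suc n)"
      using u(2)[OF that] that by (simp add: T_def)
    with k show ?thesis by (simp only: mult_less_cancel_left_pos)
  qed
  have "\<exists>a. \<Inter>(range (\<lambda>n. T (u n))) = {a}"
  proof (rule decreasing_closed_nest_sing)
    show "closed (T (u n))" for n by (rule T_closed)
    show "T (u n) \<noteq> {}" for n using u(3) by auto
    show "T (u n) \<subseteq> T (u m)" if "m \<le> n" for m n
      using lift_Suc_antimono_le[of "\<lambda>n. T (u n)", OF T_trans[OF u(3)] that] .
    fix e :: real assume "e > 0"
    then obtain n where n: "1 / real (Suc n) < e / 2"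
      using nat_approx_posE[of "e / 2"] by auto
    have "dist y z < e" if "y \<in> T (u n)" "z \<in> T (u n)" for y z
      using small[OF that(1)] small[OF that(2)] n dist_triangle3[of y z "u n"] by linarith
    then show "\<exists>n. \<forall>x\<in>T (u n). \<forall>y\<in>T (u n). dist x y < e" by blast
  qed
  then obtain a where a: "(\<Inter>n. T (u n)) = {a}" by auto
  then have "a \<in> T x0" using T_trans[OF u(1)] by blast
  moreover have "\<psi> a - \<kappa> * dist a y \<le> \<psi> y" if "y \<in> S" for y
  proof (rule ccontr)
    assume *: "\<not> ?thesis"
    with that have "y \<in> T a" by (simp add: T_def)
    moreover have "a \<in> T (u n)" for n using a by blast
    ultimately have "y \<in> (\<Inter>n. T (u n))" using T_trans by blast
    with a have "y = a" by auto
    with * show False by simp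
  qed
  ultimately show ?thesis using that[of a] by (auto simp: T_def)
qed

section \<open>Finite partitions of unity and extension from compact sets\<close>

lemma subordinate_bumps:
  fixes A :: "'k::metric_space set"
  assumes A: "compact A" "A \<noteq> {}" and \<rho>: "\<And>i. i \<in> A \<Longrightarrow> 0 < \<rho> i"
  obtains I and w :: "'k \<Rightarrow> 'k \<Rightarrow> real" where
    "finite I" "I \<subseteq> A" "\<And>i. continuous_on UNIV (w i)" "\<And>i t. 0 \<le> w i t"
    "\<And>i t. w i t \<noteq> 0 \<Longrightarrow> dist i t < \<rho> i"
    "\<And>t. (\<Sum>i\<in>I. w i t) \<le> 1" "\<And>t. t \<in> A \<Longrightarrow> (\<Sum>i\<in>I. w i t) = 1"
proof -
  have "A \<subseteq> (\<Union>i\<in>A. ball i (\<rho> i))" using \<rho> by force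
  then obtain I where I: "I \<subseteq> A" "finite I" "A \<subseteq> (\<Union>i\<in>I. ball i (\<rho> i))"
    using compactE_image[OF A(1), of A "\<lambda>i. ball i (\<rho> i)"] by (metis open_ball)
  define u where "u i t = max 0 (\<rho> i - dist i t)" for i t :: 'k
  \<comment> \<open>The distance to \<open>A\<close> vanishes on \<open>A\<close>, where the weights
    must sum to 1, and keeps the denominator positive elsewhere. The weights are thus continuous on
    the whole space and sum to at most 1.\<close>
  define W where "W t = (\<Sum>i\<in>I. u i t) + infdist t A" for t
  have u0: "u i t \<ge> 0" for i t by (simp add: u_def)
  have W: "W t > 0" for t
  proof (cases "t \<in> A")
    case True
    then obtain i where "i \<in> I" "dist i t < \<rho> i" using I(3) by auto
    then have "0 < (\<Sum>i\<in>I. u i t)"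
      using I(2) u0 by (intro sum_pos2[of _ i]) (auto simp: u_def)
    then show ?thesis using infdist_nonneg[of t A] by (simp add: W_def)
  next
    case False
    then have "infdist t A > 0"
      using A by (simp add: infdist_pos_not_in_closed compact_imp_closed)
    then show ?thesis using u0 by (simp add: W_def sum_nonneg add_nonneg_pos)
  qed
  have contW: "continuous_on UNIV W" unfolding W_def u_def by (intro continuous_intros)
  have sum: "(\<Sum>i\<in>I. u i t / W t) = (\<Sum>i\<in>I. u i t) / W t" for t
    by (simp add: sum_divide_distrib)
  show ?thesis
  proof (rule that[of I "\<lambda>i t. u i t / W t"])
    show "continuous_on UNIV (\<lambda>t. u i t / W t)" for i
      using W contW unfolding u_def by (intro continuous_intros) (auto simp: less_imp_neq[symmetric])
    show "0 \<le> u i t / W t" for i t using u0[of i t] W[of t] by simp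
    show "dist i t < \<rho> i" if "u i t / W t \<noteq> 0" for i t
      using that by (auto simp: u_def max_def split: if_splits)
    show "(\<Sum>i\<in>I. u i t / W t) \<le> 1" for t
      using W[of t] infdist_nonneg[of t A] by (simp add: sum divide_le_eq) (simp add: W_def)
    show "(\<Sum>i\<in>I. u i t / W t) = 1" if "t \<in> A" for t
      using W[of t] that by (simp add: sum) (simp add: W_def)
  qed (use I in auto)
qed

text \<open>On \<open>A\<close>, the value of \<open>h\<close> is a convex combination of values of
  \<open>g\<close> at points within the modulus of uniform continuity. Everywhere the weights sum to
  at most 1, which preserves the bound \<open>M\<close>; this bound makes the corrections summable
  when the construction is iterated.\<close>

lemma approximate_extension:
  fixes g :: "'k::metric_space \<Rightarrow> 'a::real_normed_vector"
  assumes A: "compact A" "A \<noteq> {}" and g: "continuous_on A g"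
    and M: "\<And>t. t \<in> A \<Longrightarrow> norm (g t) \<le> M" and e: "e > 0"
  shows "\<exists>h\<in>bcontfun. (\<forall>t. norm (h t) \<le> M) \<and> (\<forall>t\<in>A. norm (g t - h t) \<le> e)"
proof -
  obtain d where d: "d > 0" "\<And>s t. s \<in> A \<Longrightarrow> t \<in> A \<Longrightarrow> dist s t < d \<Longrightarrow> dist (g s) (g t) < e"
    using compact_uniformly_continuous[OF g A(1)] e unfolding uniformly_continuous_on_def by blast
  obtain I and w :: "'k \<Rightarrow> 'k \<Rightarrow> real" where I: "finite I" "I \<subseteq> A"
    and w: "\<And>i. continuous_on UNIV (w i)" "\<And>i t. 0 \<le> w i t" "\<And>i t. w i t \<noteq> 0 \<Longrightarrow> dist i t < d"
      "\<And>t. (\<Sum>i\<in>I. w i t) \<le> 1" "\<And>t. t \<in> A \<Longrightarrow> (\<Sum>i\<in>I. w i t) = 1"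
    using subordinate_bumps[OF A, of "\<lambda>_. d"] d(1) by blast
  define h where "h t = (\<Sum>i\<in>I. w i t *\<^sub>R g i)" for t
  have "M \<ge> 0" using A(2) M by (meson all_not_in_conv norm_ge_zero order_trans)
  have norm_h: "norm (h t) \<le> M" for t
  proof -
    have "norm (h t) \<le> (\<Sum>i\<in>I. w i t * M)"
      unfolding h_def using I(2) M w(2) by (intro sum_norm_le) (auto intro!: mult_left_mono)
    also have "\<dots> \<le> 1 * M"
      unfolding sum_distrib_right[symmetric] using w(4) \<open>M \<ge> 0\<close> by (rule mult_right_mono)
    finally show ?thesis by simp
  qed
  have "continuous_on UNIV h" unfolding h_def using w(1) by (intro continuous_intros)
  then have "h \<in> bcontfun" using norm_h by (rule bcontfun_normI)
  moreover have "norm (g t - h t) \<le> e" if "t \<in> A" for t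
  proof -
    have "g t - h t = (\<Sum>i\<in>I. w i t *\<^sub>R (g t - g i))"
      using w(5)[OF that] by (simp add: h_def scaleR_right_diff_distrib sum_subtractf scaleR_left.sum[symmetric])
    also have "norm \<dots> \<le> (\<Sum>i\<in>I. w i t * e)"
    proof (rule sum_norm_le)
      fix i assume i: "i \<in> I"
      show "norm (w i t *\<^sub>R (g t - g i)) \<le> w i t * e"
      proof (cases "w i t = 0")
        case False
        then have "norm (g t - g i) \<le> e"
          using d(2)[of i t] w(3) I(2) i that by (auto simp: dist_norm norm_minus_commute less_imp_le)
        then show ?thesis using w(2)[of i t] by (simp add: mult_left_mono)
      qed simp
    qed
    also have "\<dots> = e" using w(5)[OF that] by (simp add: sum_distrib_right[symmetric])
    finally show ?thesis .
  qed
  ultimately show ?thesis using norm_h by blast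
qed

instance bcontfun :: (metric_space, banach) banach ..

text \<open>The library's Dugundji theorem needs a second countable domain and an inner product space as
  target, so the extension is obtained here by iterating the approximate one.\<close>
lemma compact_extension_bcontfun:
  fixes g :: "'k::metric_space \<Rightarrow> 'a::banach"
  assumes A: "compact A" "A \<noteq> {}" and g: "continuous_on A g"
  obtains h :: "'k \<Rightarrow>\<^sub>C 'a" where "\<And>t. t \<in> A \<Longrightarrow> apply_bcontfun h t = g t"
proof -
  have "bounded (g ` A)" using A(1) g by (intro compact_imp_bounded compact_continuous_image)
  then obtain M where M: "M > 0" "\<And>t. t \<in> A \<Longrightarrow> norm (g t) \<le> M"
    unfolding bounded_pos by auto
  \<comment> \<open>The residual on \<open>A\<close> halves at each stage. Approximating the current
    residual costs a correction of norm at most \<open>M / 2 ^ n\<close> on the whole type, so the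
    partial sums form a Cauchy sequence.\<close>
  let ?P = "\<lambda>n (S::'k \<Rightarrow>\<^sub>C 'a). \<forall>t\<in>A. norm (g t - apply_bcontfun S t) \<le> M / 2 ^ n"
  have "\<exists>S. \<forall>n. ?P n (S n) \<and> dist (S n) (S (Suc n)) \<le> M / 2 ^ n"
  proof (rule dependent_nat_choice)
    show "\<exists>S. ?P 0 S" using M by (intro exI[of _ 0]) auto
    fix S n assume S: "?P n S"
    have "continuous_on A (\<lambda>t. g t - apply_bcontfun S t)"
      using g by (intro continuous_intros) auto
    from approximate_extension[OF A this, of "M / 2 ^ n" "M / 2 ^ Suc n"] S M
    obtain h where h: "h \<in> bcontfun" "\<And>t. norm (h t) \<le> M / 2 ^ n"
      "\<And>t. t \<in> A \<Longrightarrow> norm ((g t - apply_bcontfun S t) - h t) \<le> M / 2 ^ Suc n"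
      by auto
    have "?P (Suc n) (S + Bcontfun h)"
      using h by (auto simp: Bcontfun_inverse algebra_simps)
    moreover have "dist S (S + Bcontfun h) \<le> M / 2 ^ n"
      using h M by (intro dist_bound) (auto simp: Bcontfun_inverse dist_norm)
    ultimately show "\<exists>S'. ?P (Suc n) S' \<and> dist S S' \<le> M / 2 ^ n" by blast
  qed
  then obtain S where S: "\<And>n t. t \<in> A \<Longrightarrow> norm (g t - apply_bcontfun (S n) t) \<le> M / 2 ^ n"
    "\<And>n. dist (S n) (S (Suc n)) \<le> M / 2 ^ n" by auto
  have "Cauchy S"
  proof -
    have "summable (\<lambda>n. S (Suc n) - S n)"
    proof (rule summable_comparison_test')
      show "summable (\<lambda>n. M * (1 / 2) ^ n)" by (intro summable_mult summable_geometric) simp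
      show "norm (S (Suc n) - S n) \<le> M * (1 / 2) ^ n" for n
        using S(2)[of n] by (simp add: dist_norm norm_minus_commute power_one_over)
    qed
    then have "convergent (\<lambda>n. \<Sum>i<n. S (Suc i) - S i)" by (simp add: summable_iff_convergent)
    then have "convergent (\<lambda>n. S n - S 0 + S 0)" 
      by (intro convergent_add convergent_const) (simp add: sum_lessThan_telescope)
    then show ?thesis by (simp add: convergent_Cauchy)
  qed
  then obtain h where h: "S \<longlonglongrightarrow> h" by (auto simp: Cauchy_convergent_iff convergent_def)
  have "apply_bcontfun h t = g t" if "t \<in> A" for t
  proof -
    have "(\<lambda>n. apply_bcontfun (S n) t) \<longlonglongrightarrow> apply_bcontfun h t"
      using tendsto_bcontfun_uniform_limit[OF h] by (rule tendsto_uniform_limitI) simp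
    moreover have "(\<lambda>n. apply_bcontfun (S n) t) \<longlonglongrightarrow> g t"
    proof -
      have "(\<lambda>n. M * (1 / 2) ^ n) \<longlonglongrightarrow> 0" by (intro tendsto_mult_right_zero LIMSEQ_power_zero) simp
      moreover have "norm (apply_bcontfun (S n) t - g t) \<le> M * (1 / 2) ^ n" for n
        using S(1)[OF that, of n] by (simp add: power_one_over norm_minus_commute)
      ultimately have "(\<lambda>n. apply_bcontfun (S n) t - g t) \<longlonglongrightarrow> 0"
        by (rule Lim_null_comparison[OF always_eventually, OF allI, rotated])
      then show ?thesis by (rule LIM_zero_cancel)
    qed
    ultimately show ?thesis by (rule LIMSEQ_unique)
  qed
  then show ?thesis by (rule that)
qed

section \<open>Descent fields on compact sets\<close>

text \<open>Finitely many local directions are combined with bump weights, and \<open>w\<close> is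
  the total weight: the full rate \<open>d\<close> holds on \<open>B\<close>, and elsewhere descent
  is guaranteed in proportion to \<open>w\<close>. Finiteness gives one \<open>\<mu>0\<close> for
  all \<open>t\<close>, also those outside \<open>B\<close>.\<close>

lemma descent_field:
  fixes p :: "'k::metric_space \<Rightarrow> 'a::real_normed_vector"
  assumes B: "compact B" "B \<noteq> {}" "B \<subseteq> U" "open U" and p: "continuous_on UNIV p"
    and loc: "\<And>t. t \<in> B \<Longrightarrow> \<exists>v r. norm v = 1 \<and> r > 0 \<and>
      (\<forall>y \<mu>. dist y (p t) < r \<longrightarrow> 0 < \<mu> \<longrightarrow> \<mu> < r \<longrightarrow> f (y + \<mu> *\<^sub>R v) \<le> f y - d * \<mu>)"
  obtains V w \<mu>0 where "V \<in> bcontfun" "continuous_on UNIV w"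
    "\<And>t. norm (V t) \<le> 1" "\<And>t. t \<notin> U \<Longrightarrow> V t = 0" "\<And>t. t \<in> B \<Longrightarrow> w t = 1" "\<mu>0 > 0"
    "\<And>t \<mu>. 0 < \<mu> \<Longrightarrow> \<mu> < \<mu>0 \<Longrightarrow> f (p t + \<mu> *\<^sub>R V t) \<le> f (p t) - d * \<mu> * w t"
proof -
  obtain v r where v: "\<And>t. t \<in> B \<Longrightarrow> norm (v t) = 1" "\<And>t. t \<in> B \<Longrightarrow> r t > 0"
    "\<And>t y \<mu>. t \<in> B \<Longrightarrow> dist y (p t) < r t \<Longrightarrow> 0 < \<mu> \<Longrightarrow> \<mu> < r t \<Longrightarrow> f (y + \<mu> *\<^sub>R v t) \<le> f y - d * \<mu>"
    using loc by metis
  \<comment> \<open>Half of the radius \<open>r t\<close> is spent on the variation of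
    \<open>p\<close> over the small ball; the other half is left for displacements by the field, of
    length at most \<open>\<mu>\<close>.\<close>
  have "\<exists>\<rho>>0. ball t \<rho> \<subseteq> U \<inter> p -` ball (p t) (r t / 2)" if "t \<in> B" for t
  proof -
    have "open (U \<inter> p -` ball (p t) (r t / 2))"
      using B(4) p by (intro open_Int open_vimage) auto
    moreover have "t \<in> U \<inter> p -` ball (p t) (r t / 2)" using that B(3) v(2) by auto
    ultimately show ?thesis by (meson openE)
  qed
  then obtain \<rho> where \<rho>: "\<And>t. t \<in> B \<Longrightarrow> 0 < \<rho> t"
    "\<And>t. t \<in> B \<Longrightarrow> ball t (\<rho> t) \<subseteq> U \<inter> p -` ball (p t) (r t / 2)" by metis
  obtain I and w :: "'k \<Rightarrow> 'k \<Rightarrow> real" where I: "finite I" "I \<subseteq> B"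
    and w: "\<And>i. continuous_on UNIV (w i)" "\<And>i t. 0 \<le> w i t" "\<And>i t. w i t \<noteq> 0 \<Longrightarrow> dist i t < \<rho> i"
      "\<And>t. (\<Sum>i\<in>I. w i t) \<le> 1" "\<And>t. t \<in> B \<Longrightarrow> (\<Sum>i\<in>I. w i t) = 1"
  proof (rule subordinate_bumps[OF B(1,2), of \<rho>])
    show "0 < \<rho> t" if "t \<in> B" for t by (rule \<rho>(1)[OF that])
  qed (rule that; simp)
  have near: "t \<in> U \<and> dist (p t) (p i) < r i / 2" if "i \<in> I" "w i t \<noteq> 0" for i t
    using \<rho>(2)[of i] w(3)[OF that(2)] that(1) I(2) by (auto simp: subset_eq dist_commute)
  define V where "V J t = (\<Sum>i\<in>J. w i t *\<^sub>R v i)" for J t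
  define \<mu>0 where "\<mu>0 = Min (insert 1 ((\<lambda>i. r i / 2) ` I))"
  have \<mu>0: "\<mu>0 > 0" "\<And>i. i \<in> I \<Longrightarrow> \<mu>0 \<le> r i / 2"
  proof -
    show "\<mu>0 > 0" using I v(2) by (auto simp: \<mu>0_def subset_eq)
    show "\<mu>0 \<le> r i / 2" if "i \<in> I" for i
      unfolding \<mu>0_def using I(1) that by (intro Min_le) auto
  qed
  have norm_V: "norm (V J t) \<le> 1" if "J \<subseteq> I" for J t
  proof -
    have "norm (V J t) \<le> (\<Sum>i\<in>J. w i t)"
      unfolding V_def using that I(2) v(1) w(2) by (intro sum_norm_le) (auto simp: subset_eq)
    also have "\<dots> \<le> (\<Sum>i\<in>I. w i t)" using that I(1) w(2) by (intro sum_mono2) auto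
    finally show ?thesis using w(4)[of t] by linarith
  qed
  \<comment> \<open>The directions are switched on one after the other: every intermediate point stays in the
    balls where all the relevant descent estimates hold.\<close>
  have "f (p t + \<mu> *\<^sub>R V J t) \<le> f (p t) - d * \<mu> * (\<Sum>i\<in>J. w i t)"
    if J: "finite J" "J \<subseteq> I" and \<mu>: "0 < \<mu>" "\<mu> < \<mu>0" for J t \<mu>
    using J
  proof (induction J rule: finite_induct)
    case empty
    then show ?case by (simp add: V_def)
  next
    case (insert j J)
    let ?y = "p t + \<mu> *\<^sub>R V J t"
    have j: "j \<in> I" "j \<in> B" using insert.prems I(2) by auto
    have IH: "f ?y \<le> f (p t) - d * \<mu> * (\<Sum>i\<in>J. w i t)" using insert by auto
    have V: "p t + \<mu> *\<^sub>R V (insert j J) t = ?y + (\<mu> * w j t) *\<^sub>R v j"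
      using insert.hyps by (simp add: V_def algebra_simps)
    show ?case
    proof (cases "w j t = 0")
      case True
      then show ?thesis using IH insert.hyps unfolding V by simp
    next
      case False
      have w1: "0 < w j t" "w j t \<le> 1"
        using False w(2)[of j t] w(4)[of t] member_le_sum[of j I "\<lambda>i. w i t", OF j(1) w(2) I(1)] by auto
      have "dist ?y (p j) \<le> dist ?y (p t) + dist (p t) (p j)" by (rule dist_triangle)
      also have "dist ?y (p t) \<le> \<mu>"
        using norm_V[of J t] insert.prems \<mu>(1) by (simp add: dist_norm)
      finally have "dist ?y (p j) < r j"
        using near[OF j(1) False] \<mu>(2) \<mu>0(2)[OF j(1)] by linarith
      moreover have "\<mu> * w j t < r j"
      proof -
        have "\<mu> * w j t \<le> \<mu>" using w1 \<mu>(1) by (simp add: mult_left_le)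
        then show ?thesis using \<mu>(2) \<mu>0(2)[OF j(1)] v(2)[OF j(2)] by linarith
      qed
      ultimately have "f (?y + (\<mu> * w j t) *\<^sub>R v j) \<le> f ?y - d * (\<mu> * w j t)"
        using v(3)[OF j(2)] \<mu>(1) w1(1) by simp
      then show ?thesis using IH insert.hyps unfolding V by (simp add: algebra_simps)
    qed
  qed
  then have desc: "f (p t + \<mu> *\<^sub>R V I t) \<le> f (p t) - d * \<mu> * (\<Sum>i\<in>I. w i t)" if "0 < \<mu>" "\<mu> < \<mu>0" for t \<mu>
    using I(1) that by blast
  show ?thesis
  proof (rule that[of "V I" "\<lambda>t. \<Sum>i\<in>I. w i t" \<mu>0])
    have "continuous_on UNIV (V I)" unfolding V_def using w(1) by (intro continuous_intros)
    then show "V I \<in> bcontfun" using norm_V[OF subset_refl] by (rule bcontfun_normI)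
    show "continuous_on UNIV (\<lambda>t. \<Sum>i\<in>I. w i t)" using w(1) by (intro continuous_intros)
    show "V I t = 0" if "t \<notin> U" for t
      unfolding V_def using near that by (intro sum.neutral) auto
  qed (use norm_V w \<mu>0 desc in auto)
qed

lemma GREATEST_image_compact:
  fixes g :: "'k::topological_space \<Rightarrow> real"
  assumes "compact K" "K \<noteq> {}" "continuous_on K g"
  shows "(GREATEST r. r \<in> g ` K) \<in> g ` K" and "t \<in> K \<Longrightarrow> g t \<le> (GREATEST r. r \<in> g ` K)"
proof -
  obtain s where s: "s \<in> K" "\<And>t. t \<in> K \<Longrightarrow> g t \<le> g s"
    using continuous_attains_sup[OF assms] by blast
  then have "(GREATEST r. r \<in> g ` K) = g s" by (intro Greatest_equality) auto
  with s show "(GREATEST r. r \<in> g ` K) \<in> g ` K" "t \<in> K \<Longrightarrow> g t \<le> (GREATEST r. r \<in> g ` K)"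
    by auto
qed

lemma closed_bcontfun_pointwise:
  fixes C :: "'a::complete_space set"
  assumes "closed C"
  shows "closed {p :: 'k::metric_space \<Rightarrow>\<^sub>C 'a. apply_bcontfun p t \<in> C}"
  using closed_PiC[of "{t}" "\<lambda>_. C"] assms by (auto simp: mem_PiC_iff Pi_iff elim: back_subst[where P=closed])

section \<open>Almost critical points\<close>

lemma almost_critical_point_near:
  fixes f :: "'a::banach \<Rightarrow> real"
    and K Kstar :: "'k::metric_space set"
    and pstar :: "'k \<Rightarrow> 'a"
    and F :: "'a set"
    and c e :: real
  assumes f: "locally_lipschitz f"
    and K: "compact K"
    and Kstar: "Kstar \<noteq> {}" "Kstar \<subseteq> K" "closed Kstar"
    and pstar: "continuous_on Kstar pstar"
    and c: "c = minimax_value f K Kstar pstar"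
    and F: "closed F" "F \<inter> pstar ` Kstar = {}"
    and fF: "\<And>x. x \<in> F \<Longrightarrow> f x \<ge> c"
    and link: "\<And>p. p \<in> admissible_maps K Kstar pstar \<Longrightarrow> p ` K \<inter> F \<noteq> {}"
    and e: "e > 0"
  shows "\<exists>x. infdist x F < e \<and> \<bar>f x - c\<bar> < e \<and> clarke_lambda f x \<le> e"
proof (rule ccontr)
  assume "\<not> ?thesis"
  then have lambda: "e < clarke_lambda f x" if "infdist x F < e" "\<bar>f x - c\<bar> < e" for x
    using that by (auto simp: not_le)
  have "K \<noteq> {}" using Kstar by auto
  have "compact Kstar" using K Kstar by (metis compact_Int_closed inf.absorb_iff2)
  obtain p1 :: "'k \<Rightarrow>\<^sub>C 'a" where "\<And>t. t \<in> Kstar \<Longrightarrow> apply_bcontfun p1 t = pstar t"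
    using compact_extension_bcontfun[OF \<open>compact Kstar\<close> Kstar(1) pstar] by blast
  then have p1: "apply_bcontfun p1 \<in> admissible_maps K Kstar pstar"
    by (auto simp: admissible_maps_def)
  then have "F \<noteq> {}" using link by auto
  obtain a0 where a0: "a0 > 0" "\<And>t. t \<in> Kstar \<Longrightarrow> a0 \<le> infdist (pstar t) F"
  proof -
    obtain s where s: "s \<in> Kstar" "\<And>t. t \<in> Kstar \<Longrightarrow> infdist (pstar s) F \<le> infdist (pstar t) F"
      using continuous_attains_inf[OF \<open>compact Kstar\<close> Kstar(1) continuous_on_infdist[OF pstar]] by blast
    moreover have "infdist (pstar s) F > 0"
      using F s(1) \<open>F \<noteq> {}\<close> by (intro infdist_pos_not_in_closed) auto
    ultimately show ?thesis using that by blast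
  qed
  define a where "a = min (min 1 a0) (e / 4)"
  have a: "0 < a" "a \<le> 1" "a \<le> a0" "a \<le> e / 4" using a0 e by (auto simp: a_def)
  \<comment> \<open>\<open>M\<close> is both the slope of the penalty and the Ekeland constant. The
    two losses together have rate \<open>2 * M = e / 4\<close>, below the descent rate
    \<open>e / 2\<close> available where the weight exceeds 1/2.\<close>
  define M where "M = e / 8"
  have M: "M > 0" "M * a \<le> e / 8" using e a by (auto simp: M_def mult_left_le)
  define h where "h x = M * max 0 (a - infdist x F)" for x
  define G where "G x = f x + h x" for x
  have h: "0 \<le> h x" "h x \<le> M * a" for x
    using M a infdist_nonneg[of x F] by (auto simp: h_def intro!: mult_left_mono)
  have h_lip: "h y \<le> h x + M * dist x y" for x y
  proof -
    have "M * max 0 (a - infdist y F) \<le> M * (max 0 (a - infdist x F) + dist x y)"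
      using M infdist_triangle[of x F y] by (intro mult_left_mono) auto
    then show ?thesis by (simp add: h_def distrib_left)
  qed
  have contG: "continuous_on UNIV G"
    unfolding G_def h_def using locally_lipschitz_continuous[OF f] by (intro continuous_intros)
  have contGp: "continuous_on K (\<lambda>t. G (apply_bcontfun p t))" for p :: "'k \<Rightarrow>\<^sub>C 'a"
    by (rule continuous_on_compose2[OF contG]) auto
  \<comment> \<open>The excess \<open>M * a / 2\<close> is half the penalty height: it keeps frozen
    times below \<open>c + M * a\<close>, and it limits the Ekeland displacement to
    \<open>a / 2\<close>.\<close>
  obtain p where p: "p \<in> admissible_maps K Kstar pstar"
    "(GREATEST r. r \<in> (\<lambda>t. f (p t)) ` K) < c + M * a / 2"
    using cInf_lessD[of "(\<lambda>p. GREATEST r. r \<in> (\<lambda>t. f (p t)) ` K) ` admissible_maps K Kstar pstar" "c + M * a / 2"]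
      p1 M(1) a(1) by (auto simp: c minimax_value_def)
  have contp: "continuous_on K p" using p(1) by (simp add: admissible_maps_def)
  \<comment> \<open>Ekeland's principle is applied in the complete space of bounded continuous maps
    on the whole type, so the map on \<open>K\<close> is extended first.\<close>
  obtain p0 :: "'k \<Rightarrow>\<^sub>C 'a" where p0: "\<And>t. t \<in> K \<Longrightarrow> apply_bcontfun p0 t = p t"
    using compact_extension_bcontfun[OF K \<open>K \<noteq> {}\<close> contp] by blast
  have fp0: "f (apply_bcontfun p0 t) < c + M * a / 2" if "t \<in> K" for t
  proof -
    have "continuous_on K (\<lambda>t. f (p t))"
      by (rule continuous_on_compose2[OF locally_lipschitz_continuous[OF f, of UNIV] contp]) simp
    from GREATEST_image_compact(2)[OF K \<open>K \<noteq> {}\<close> this that] p(2) show ?thesis by (simp add: p0[OF that])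
  qed
  \<comment> \<open>Only maps agreeing with \<open>p0\<close> away from \<open>F\<close> compete: the penalty \<open>h\<close> then forces the
    maximum of \<open>G\<close> along a competitor to be attained close to \<open>F\<close>.\<close>
  define E where "E = {t. a \<le> infdist (apply_bcontfun p0 t) F}"
  define S where "S = {q :: 'k \<Rightarrow>\<^sub>C 'a. \<forall>t\<in>E. apply_bcontfun q t = apply_bcontfun p0 t}"
  define \<psi> where "\<psi> q = (GREATEST r. r \<in> (\<lambda>t. G (apply_bcontfun q t)) ` K)" for q :: "'k \<Rightarrow>\<^sub>C 'a"
  have \<psi>_max: "\<exists>t\<in>K. \<psi> q = G (apply_bcontfun q t)" for q
    using GREATEST_image_compact(1)[OF K \<open>K \<noteq> {}\<close> contGp, of q] by (auto simp: \<psi>_def)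
  have \<psi>_ge: "G (apply_bcontfun q t) \<le> \<psi> q" if "t \<in> K" for q t
    using GREATEST_image_compact(2)[OF K \<open>K \<noteq> {}\<close> contGp that] by (auto simp: \<psi>_def)
  have KstarE: "Kstar \<subseteq> E"
  proof
    fix t assume t: "t \<in> Kstar"
    then have "apply_bcontfun p0 t = pstar t" using p0 p(1) Kstar(2) by (auto simp: admissible_maps_def)
    then show "t \<in> E" using a(3) a0(2)[OF t] by (simp add: E_def)
  qed
  have \<psi>_lower: "c + M * a \<le> \<psi> q" if "q \<in> S" for q
  proof -
    have "apply_bcontfun q t = pstar t" if "t \<in> Kstar" for t
    proof -
      have "apply_bcontfun q t = apply_bcontfun p0 t" using \<open>q \<in> S\<close> KstarE that by (auto simp: S_def)
      then show ?thesis using p0[of t] p(1) Kstar(2) that by (auto simp: admissible_maps_def)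
    qed
    then have "apply_bcontfun q \<in> admissible_maps K Kstar pstar"
      by (auto simp: admissible_maps_def)
    then obtain t where t: "t \<in> K" "apply_bcontfun q t \<in> F" using link by blast
    then have "c + M * a \<le> G (apply_bcontfun q t)"
      using fF[OF t(2)] a(1) by (simp add: G_def h_def)
    also have "\<dots> \<le> \<psi> q" using \<psi>_ge[OF t(1)] .
    finally show ?thesis .
  qed
  have \<psi>_p0: "\<psi> p0 \<le> c + M * a / 2 + M * a"
  proof -
    obtain t where t: "t \<in> K" "\<psi> p0 = G (apply_bcontfun p0 t)" using \<psi>_max by blast
    then show ?thesis using fp0[OF t(1)] h(2)[of "apply_bcontfun p0 t"] by (simp add: G_def)
  qed
  have lsc: "closed {q \<in> S. \<psi> q \<le> \<alpha>}" for \<alpha>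
  proof -
    have "\<psi> q \<le> \<alpha> \<longleftrightarrow> (\<forall>t\<in>K. G (apply_bcontfun q t) \<le> \<alpha>)" for q
      using \<psi>_ge[of _ q] \<psi>_max[of q] by (metis order_trans)
    then have "{q \<in> S. \<psi> q \<le> \<alpha>} =
      (\<Inter>t\<in>E. {q. apply_bcontfun q t \<in> {apply_bcontfun p0 t}}) \<inter>
      (\<Inter>t\<in>K. {q. apply_bcontfun q t \<in> {x. G x \<le> \<alpha>}})"
      by (auto simp: S_def)
    moreover have "closed {x. G x \<le> \<alpha>}"
      by (intro closed_Collect_le contG continuous_on_const)
    ultimately show ?thesis
      by (simp only:) (intro closed_Int closed_INT ballI closed_bcontfun_pointwise closed_singleton)
  qed
  have "p0 \<in> S" by (simp add: S_def)
  obtain q where q: "q \<in> S" "\<psi> q + M * dist p0 q \<le> \<psi> p0"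
    "\<And>y. y \<in> S \<Longrightarrow> \<psi> q - M * dist q y \<le> \<psi> y"
    using Ekeland_variational_principle[OF lsc \<psi>_lower \<open>p0 \<in> S\<close> M(1)] by blast
  have "M * dist p0 q \<le> M * (a / 2)" using q(2) \<psi>_lower[OF q(1)] \<psi>_p0 by simp
  then have dist_q: "dist p0 q \<le> a / 2" using M(1) by (simp only: mult_le_cancel_left_pos)
  \<comment> \<open>These are the maximizing times: by \<open>\<psi>_ge\<close> the inequality is an
    equality, and in this form the set is visibly closed.\<close>
  define B where "B = {t \<in> K. \<psi> q \<le> G (apply_bcontfun q t)}"
  have "compact B"
  proof -
    have "closed {t. \<psi> q \<le> G (apply_bcontfun q t)}"
      by (intro closed_Collect_le continuous_on_compose2[OF contG] continuous_intros) auto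
    then show ?thesis using K by (simp add: B_def Collect_conj_eq compact_Int_closed)
  qed
  have "B \<noteq> {}" using \<psi>_max[of q] by (auto simp: B_def)
  have BU: "B \<subseteq> - E"
  proof
    fix t assume t: "t \<in> B"
    show "t \<in> - E"
    proof
      assume tE: "t \<in> E"
      then have "apply_bcontfun q t = apply_bcontfun p0 t" using q(1) by (simp add: S_def)
      moreover have "h (apply_bcontfun p0 t) = 0" using tE by (simp add: E_def h_def)
      ultimately have "\<psi> q < c + M * a / 2" using t fp0[of t] by (simp add: B_def G_def)
      moreover have "M * a > 0" using M(1) a(1) by simp
      ultimately show False using \<psi>_lower[OF q(1)] by simp
    qed
  qed
  have "open (- E)"
    unfolding E_def by (intro open_Compl closed_Collect_le continuous_intros) auto
  have loc: "\<exists>v r. norm v = 1 \<and> r > 0 \<and>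
      (\<forall>y \<mu>. dist y (apply_bcontfun q t) < r \<longrightarrow> 0 < \<mu> \<longrightarrow> \<mu> < r \<longrightarrow> f (y + \<mu> *\<^sub>R v) \<le> f y - e * \<mu>)"
    if t: "t \<in> B" for t
  proof -
    let ?x = "apply_bcontfun q t"
    have "infdist ?x F \<le> infdist (apply_bcontfun p0 t) F + dist ?x (apply_bcontfun p0 t)"
      by (rule infdist_triangle)
    also have "\<dots> < a + a / 2"
      using BU t dist_q dist_bounded[of q t p0] by (auto simp: E_def dist_commute)
    also have "\<dots> < e" using a(4) e by simp
    finally have "infdist ?x F < e" .
    moreover have "\<bar>f ?x - c\<bar> < e"
    proof -
      have "\<psi> q \<le> f ?x + h ?x" "f ?x + h ?x \<le> \<psi> q" using t \<psi>_ge[of t q] by (auto simp: B_def G_def)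
      moreover have "\<psi> q \<le> \<psi> p0" using q(2) M(1) by (smt (verit) mult_nonneg_nonneg zero_le_dist)
      ultimately show ?thesis
        using h[of ?x] \<psi>_lower[OF q(1)] \<psi>_p0 M(2) e by (auto simp: abs_less_iff)
    qed
    ultimately show ?thesis
      using clarke_lambda_greater_descent[OF f less_imp_le[OF e] lambda] by metis
  qed
  obtain V w \<mu>0 where V: "V \<in> bcontfun" "continuous_on UNIV w"
    "\<And>t. norm (V t) \<le> 1" "\<And>t. t \<notin> - E \<Longrightarrow> V t = 0" "\<And>t. t \<in> B \<Longrightarrow> w t = 1" "\<mu>0 > 0"
    "\<And>t \<mu>. 0 < \<mu> \<Longrightarrow> \<mu> < \<mu>0 \<Longrightarrow> f (apply_bcontfun q t + \<mu> *\<^sub>R V t) \<le> f (apply_bcontfun q t) - e * \<mu> * w t"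
    using descent_field[OF \<open>compact B\<close> \<open>B \<noteq> {}\<close> BU \<open>open (- E)\<close> continuous_on_apply_bcontfun loc] by blast
  \<comment> \<open>\<open>Suc (Suc n)\<close> keeps every step strictly below
    \<open>\<mu>0\<close>, already for \<open>n = 0\<close>.\<close>
  define \<mu> where "\<mu> n = \<mu>0 / real (Suc (Suc n))" for n
  have \<mu>: "0 < \<mu> n" "\<mu> n < \<mu>0" for n using V(6) by (auto simp: \<mu>_def divide_less_eq)
  have \<mu>_lim: "\<mu> \<longlonglongrightarrow> 0"
    unfolding \<mu>_def by (rule LIMSEQ_Suc, rule LIMSEQ_Suc, rule lim_const_over_n)
  \<comment> \<open>A maximizing time of the perturbed map may lie outside \<open>B\<close>, where
    \<open>w\<close> could be small. As the steps shrink, such times accumulate at a point of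
    \<open>B\<close> by compactness of \<open>K\<close> and continuity of \<open>G\<close>; there
    \<open>w\<close> is 1, so it exceeds 1/2 for some step.\<close>
  have "\<exists>t\<in>K. \<psi> q - M * \<mu> n \<le> G (apply_bcontfun q t + \<mu> n *\<^sub>R V t)" for n
  proof -
    define y where "y = q + \<mu> n *\<^sub>R Bcontfun V"
    have y: "apply_bcontfun y t = apply_bcontfun q t + \<mu> n *\<^sub>R V t" for t
      by (simp add: y_def Bcontfun_inverse[OF V(1)])
    have "y \<in> S" using q(1) V(4) by (auto simp: S_def y)
    have "dist q y \<le> \<mu> n"
    proof (rule dist_bound)
      show "dist (apply_bcontfun q t) (apply_bcontfun y t) \<le> \<mu> n" for t
        using \<mu>(1)[of n] V(3)[of t] by (simp add: y dist_norm mult_left_le)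
    qed
    then have "M * dist q y \<le> M * \<mu> n" using M(1) by simp
    then have "\<psi> q - M * \<mu> n \<le> \<psi> y" using q(3)[OF \<open>y \<in> S\<close>] by linarith
    then show ?thesis using \<psi>_max[of y] by (auto simp: y)
  qed
  then obtain t where t: "\<And>n. t n \<in> K" "\<And>n. \<psi> q - M * \<mu> n \<le> G (apply_bcontfun q (t n) + \<mu> n *\<^sub>R V (t n))"
    by metis
  obtain l r where l: "l \<in> K" "strict_mono r" "(t \<circ> r) \<longlonglongrightarrow> l"
    using K t(1) unfolding compact_def by blast
  have \<mu>r: "(\<lambda>n. \<mu> (r n)) \<longlonglongrightarrow> 0"
    using LIMSEQ_subseq_LIMSEQ[OF \<mu>_lim l(2)] by (simp add: o_def)
  have "l \<in> B"
  proof -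
    have "(\<lambda>n. \<mu> (r n) *\<^sub>R V (t (r n))) \<longlonglongrightarrow> 0"
    proof (rule Lim_null_comparison[OF always_eventually \<mu>r], rule allI)
      show "norm (\<mu> (r n) *\<^sub>R V (t (r n))) \<le> \<mu> (r n)" for n
        using \<mu>(1)[of "r n"] V(3)[of "t (r n)"] by (simp add: mult_left_le)
    qed
    moreover have "(\<lambda>n. apply_bcontfun q (t (r n))) \<longlonglongrightarrow> apply_bcontfun q l"
      using continuous_on_tendsto_compose[OF continuous_on_apply_bcontfun[of UNIV q] l(3)] by (simp add: o_def)
    ultimately have "(\<lambda>n. apply_bcontfun q (t (r n)) + \<mu> (r n) *\<^sub>R V (t (r n))) \<longlonglongrightarrow> apply_bcontfun q l"
      using tendsto_add by fastforce
    from continuous_on_tendsto_compose[OF contG this]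
    have "(\<lambda>n. G (apply_bcontfun q (t (r n)) + \<mu> (r n) *\<^sub>R V (t (r n)))) \<longlonglongrightarrow> G (apply_bcontfun q l)" by simp
    moreover have "(\<lambda>n. \<psi> q - M * \<mu> (r n)) \<longlonglongrightarrow> \<psi> q - M * 0"
      by (intro tendsto_intros \<mu>r)
    ultimately have "\<psi> q - M * 0 \<le> G (apply_bcontfun q l)"
      using t(2) by (intro LIMSEQ_le) auto
    with l(1) show ?thesis by (simp add: B_def)
  qed
  then have "(\<lambda>n. w (t (r n))) \<longlonglongrightarrow> 1"
    using continuous_on_tendsto_compose[OF V(2) l(3)] V(5)[of l] by (simp add: o_def)
  then have "\<forall>\<^sub>F n in sequentially. 1 / 2 < w (t (r n))" by (rule order_tendstoD) simp
  then obtain n where n: "1 / 2 < w (t (r n))" by (auto simp: eventually_sequentially)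
  define m s where "m = \<mu> (r n)" and "s = t (r n)"
  let ?x = "apply_bcontfun q s"
  have m: "0 < m" "m < \<mu>0" using \<mu> by (auto simp: m_def)
  have "h (?x + m *\<^sub>R V s) \<le> h ?x + M * m"
  proof -
    have "M * dist ?x (?x + m *\<^sub>R V s) \<le> M * m"
      using m(1) M(1) V(3)[of s] by (simp add: dist_norm mult_left_le)
    then show ?thesis using h_lip[of "?x + m *\<^sub>R V s" ?x] by linarith
  qed
  moreover have "e * m * (1 / 2) \<le> e * m * w s"
    using n e m(1) by (intro mult_left_mono) (auto simp: s_def)
  moreover have "f ?x + h ?x \<le> \<psi> q" using \<psi>_ge[OF t(1)] by (simp add: G_def s_def)
  moreover have "\<psi> q - M * m \<le> f (?x + m *\<^sub>R V s) + h (?x + m *\<^sub>R V s)"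
    using t(2)[of "r n"] by (simp add: G_def s_def m_def)
  moreover have "e * m > 0" using e m(1) by simp
  ultimately show False
    using V(7)[OF m, of s] by (simp add: M_def)
qed

theorem theorem20:
  fixes f :: "'a::banach \<Rightarrow> real"
    and K Kstar :: "'k::metric_space set"
    and pstar :: "'k \<Rightarrow> 'a"
    and F :: "'a set"
    and c :: real
  assumes "locally_lipschitz f"
    and "compact K"
    and "Kstar \<noteq> {}" and "Kstar \<subseteq> K" and "closed Kstar"
    and "continuous_on Kstar pstar"
    and "c = minimax_value f K Kstar pstar"
    and "closed F" and "F \<inter> pstar ` Kstar = {}"
    and "\<And>x. x \<in> F \<Longrightarrow> f x \<ge> c"
    and "\<And>p. p \<in> admissible_maps K Kstar pstar \<Longrightarrow> p ` K \<inter> F \<noteq> {}"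
  shows "\<exists>x :: nat \<Rightarrow> 'a.
           (\<lambda>n. infdist (x n) F) \<longlonglongrightarrow> 0 \<and>
           (\<lambda>n. f (x n)) \<longlonglongrightarrow> c \<and>
           (\<lambda>n. clarke_lambda f (x n)) \<longlonglongrightarrow> 0"
proof -
  have "\<exists>x. infdist x F < 1 / Suc n \<and> \<bar>f x - c\<bar> < 1 / Suc n \<and> clarke_lambda f x \<le> 1 / Suc n" for n
    by (rule almost_critical_point_near[OF assms]) simp_all
  then obtain x where x: "\<And>n. infdist (x n) F < 1 / Suc n" "\<And>n. \<bar>f (x n) - c\<bar> < 1 / Suc n"
    "\<And>n. clarke_lambda f (x n) \<le> 1 / Suc n" by metis
  have null: "(\<lambda>n. 1 / Suc n) \<longlonglongrightarrow> (0::real)" by (rule LIMSEQ_Suc, rule lim_const_over_n)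
  have "(\<lambda>n. f (x n) - c) \<longlonglongrightarrow> 0"
    using x(2) by (intro Lim_null_comparison[OF _ null] always_eventually) (auto intro: less_imp_le)
  then have "(\<lambda>n. f (x n)) \<longlonglongrightarrow> c" by (simp add: LIM_zero_iff)
  moreover have "(\<lambda>n. infdist (x n) F) \<longlonglongrightarrow> 0"
    using x(1) by (intro Lim_null_comparison[OF _ null] always_eventually) (auto simp: infdist_nonneg intro: less_imp_le)
  moreover have "(\<lambda>n. clarke_lambda f (x n)) \<longlonglongrightarrow> 0"
    using x(3) clarke_lambda_nonneg[OF assms(1)] by (intro Lim_null_comparison[OF _ null] always_eventually) auto
  ultimately show ?thesis by blast
qed

end
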